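(* Let $M$ be an arbitrary $d\times d$ matrix dilation, $m=|\det M|$, $c\in\frac12\mathbb Z^d$, $n\in\mathbb N$, and let $\lambda'_\alpha\in\mathbb C$, $\alpha\in\Delta_n$, satisfy $\lambda'_{\mathbf 0}=1$ and $\lambda'_\alpha=0$ if $[\alpha]$ is odd. Then there exists a mask $m_0$ which is symmetric with respect to the point $c$ in the sense (a), i.e. $m_0(\xi)=e^{2\pi i(2c,\xi)}m_0(-\xi)$, and whose polyphase components $\mu_{0k}$ satisfy $$D^\beta\mu_{0k}(\mathbf 0)=\frac{(2\pi i)^{[\beta]}}{\sqrt m}\sum_{\alpha\in\mathbb Z^d_+,\,\alpha\le\beta}\lambda_\alpha\binom{\beta}{\alpha}(-M^{-1}s_k)^{\beta-\alpha}\qquad\forall\beta\in\Delta_n,\ \forall k=0,\dots,m-1,$$ with the numbers $$\lambda_\alpha=\sum_{\gamma\in\mathbb Z^d_+,\,\gamma\le\alpha}\lambda'_\gamma\binom{\alpha}{\gamma}(M^{-1}c)^{\alpha-\gamma},\qquad\alpha\in\Delta_n.$$ The mask $m_0$ can be represented by $$m_0(\xi)=\frac1m\sum_{j\in J}\sum_{\beta\in\Delta_n}\lambda'_\beta G^A_{\beta j}(M^*\xi)e^{2\pi i(c,\xi)}$$ $$+\frac1m\sum_{i\in I^1}\sum_{\beta\in\Delta_n}\ \sum_{\gamma\in\mathbb Z^d_+,\,\gamma\le\beta}\lambda'_\gamma\binom{\beta}{\gamma}(M^{-1}(c-s_i))^{\beta-\gamma}\Big(G_{\beta i}(M^*\xi)e^{2\pi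 i(s_i,\xi)}+G_{\beta i}(-M^*\xi)e^{2\pi i(2c-s_i,\xi)}\Big),$$ where $G_{\beta i}\in\Theta_{\beta,n}$, $\beta\in\Delta_n$, $i\in I^1$, are trigonometric polynomials, and $G^A_{\beta j}\in\Theta^A_{\beta,n}$, $\beta\in\Delta_n^e$, $j\in J$, are trigonometric polynomials of semi-integer degrees associated with $\sigma=M^{-1}(c-s_j)-\lfloor M^{-1}(c-s_j)\rfloor$.
   Context: Notation: $\mathbb Z^d_+=\{x\in\mathbb Z^d:x\ge\mathbf 0\}$, inequalities and floor of vectors are coordinatewise; $[\alpha]=\sum_j\alpha_j$; $\binom{\beta}{\gamma}=\beta!/(\gamma!(\beta-\gamma)!)$, $a^b=\prod_j a_j^{b_j}$; $\Delta_n=\{\alpha\in\mathbb Z^d_+:[\alpha]<n\}$, $\Delta_n^e=\{\alpha\in\Delta_n:[\alpha]\text{ even}\}$. A matrix dilation $M$ is an integer $d\times d$ matrix all of whose eigenvalues are bigger than 1 in modulus; $M^*$ is its conjugate (transpose). A set of digits $D(M)=\{s_0,\dots,s_{m-1}\}$ contains exactly one representative of each coset of $\mathbb Z^d/M\mathbb Z^d$. A trigonometric polynomial of semi-integer degrees associated with $\sigma\in\frac12\mathbb Z^d\cap[0,\frac12]^d$ is a finite sum $\sum_{k\in\mathbb Z^d}h_ke^{2\pi i(k+\sigma,\xi)}$, $h_k\in\mathbb C$; a trigonometric polynomial is the case $\sigma=\mathbf 0$. A mask is a trigonometric polynomial $m_0$ with $m_0(\mathbf 0)=1$; its polyphase components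 are the unique trigonometric polynomials $\mu_{0k}$ with $m_0(\xi)=\frac1{\sqrt m}\sum_{k=0}^{m-1}e^{2\pi i(s_k,\xi)}\mu_{0k}(M^*\xi)$. Index sets: for each $k\in\{0,\dots,m-1\}$ there is a unique $l\in\{0,\dots,m-1\}$ with $M^{-1}(2c-s_k-s_l)\in\mathbb Z^d$. $J$ is the set of those $k$ for which $l=k$; $I$ is the set of those $k$ for which $l\ne k$, and for $i\in I$ the corresponding $l$ is denoted $i'$ (also in $I$). The digits are chosen so that $s_i+s_{i'}=2c$ for all $i\in I$. $I=I^1\cup I^2$ is a disjoint splitting such that $i\in I^1$ iff $i'\in I^2$. $\Theta_{\beta,n}$ (for $\beta\in\Delta_n$) is the class of trigonometric polynomials $t$ of integer or semi-integer degrees with $D^\alpha t(\mathbf 0)=(2\pi i)^{[\alpha]}\delta_{\alpha\beta}$ for all $\alpha\in\Delta_n$; $\Theta^A_{\beta,n}=\{t\in\Theta_{\beta,n}:t(\xi)=t(-\xi)\}$ for $\beta\in\Delta_n^e$. Terms with $[\beta]$ odd in the sum over $J$ are absent since $\lambda'_\beta=0$. *)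

theory Defs
  imports "HOL-Analysis.Analysis"
begin

text \<open>Multi-indices are vectors of type \<^typ>\<open>nat^'d\<close>; the library order on vectors is
  coordinatewise.\<close>

definition vec_floor :: "real^'d \<Rightarrow> real^'d" where
  "vec_floor x = (\<chi> j. of_int \<lfloor>x $ j\<rfloor>)"

definition of_int_vec :: "int^'d \<Rightarrow> real^'d" where
  "of_int_vec k = (\<chi> j. of_int (k $ j))"

definition int_lattice :: "(real^'d) set" where
  "int_lattice = range of_int_vec"

definition half_int_lattice :: "(real^'d) set" where
  "half_int_lattice = {x. 2 *\<^sub>R x \<in> int_lattice}"

definition mi_size :: "nat^'d \<Rightarrow> nat" where
  "mi_size \<alpha> = (\<Sum>j\<in>UNIV. \<alpha> $ j)"

definition mi_fact :: "nat^'d \<Rightarrow> real" where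
  "mi_fact \<alpha> = (\<Prod>j\<in>UNIV. fact (\<alpha> $ j))"

definition mi_binom :: "nat^'d \<Rightarrow> nat^'d \<Rightarrow> real" where
  "mi_binom \<beta> \<gamma> = mi_fact \<beta> / (mi_fact \<gamma> * mi_fact (\<beta> - \<gamma>))"

definition mi_power :: "real^'d \<Rightarrow> nat^'d \<Rightarrow> real" where
  "mi_power a b = (\<Prod>j\<in>UNIV. (a $ j) ^ (b $ j))"

definition Delta :: "nat \<Rightarrow> (nat^'d) set" where
  "Delta n = {\<alpha>. mi_size \<alpha> < n}"

definition Delta_even :: "nat \<Rightarrow> (nat^'d) set" where
  "Delta_even n = {\<alpha> \<in> Delta n. even (mi_size \<alpha>)}"

definition partial_deriv :: "'d::finite \<Rightarrow> (real^'d \<Rightarrow> complex) \<Rightarrow> real^'d \<Rightarrow> complex" where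
  "partial_deriv j f x = vector_derivative (\<lambda>t. f (x + t *\<^sub>R axis j 1)) (at 0)"

text \<open>The mixed partial derivative of multi-index order. The coordinates are processed in some
  fixed order; for the smooth functions it is applied to (trigonometric polynomials) the result
  does not depend on that order.\<close>

definition mixed_deriv :: "nat^'d \<Rightarrow> (real^'d \<Rightarrow> complex) \<Rightarrow> real^'d \<Rightarrow> complex" where
  "mixed_deriv \<alpha> f =
     foldr (\<lambda>j. partial_deriv j ^^ (\<alpha> $ j)) (SOME js. distinct js \<and> set js = UNIV) f"

definition char_exp :: "real^'d \<Rightarrow> real^'d \<Rightarrow> complex" where
  "char_exp a \<xi> = exp (2 * of_real pi * \<i> * of_real (a \<bullet> \<xi>))"

definition semi_degrees :: "(real^'d) set" where
  "semi_degrees = half_int_lattice \<inter> {\<sigma>. \<forall>j. 0 \<le> \<sigma> $ j \<and> \<sigma> $ j \<le> 1/2}"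

definition semi_trig_poly :: "real^'d \<Rightarrow> (real^'d \<Rightarrow> complex) \<Rightarrow> bool" where
  "semi_trig_poly \<sigma> t \<longleftrightarrow> \<sigma> \<in> semi_degrees \<and>
     (\<exists>(K :: (int^'d) set) h. finite K \<and>
        (\<forall>\<xi>. t \<xi> = (\<Sum>k\<in>K. h k * char_exp (of_int_vec k + \<sigma>) \<xi>)))"

abbreviation trig_poly :: "(real^'d \<Rightarrow> complex) \<Rightarrow> bool" where
  "trig_poly t \<equiv> semi_trig_poly 0 t"

definition Theta :: "nat^'d \<Rightarrow> nat \<Rightarrow> (real^'d \<Rightarrow> complex) set" where
  "Theta \<beta> n = {t. (\<exists>\<sigma>. semi_trig_poly \<sigma> t) \<and>
     (\<forall>\<alpha>\<in>Delta n. mixed_deriv \<alpha> t 0 =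
        (2 * of_real pi * \<i>) ^ mi_size \<alpha> * (if \<alpha> = \<beta> then 1 else 0))}"

definition Theta_sym :: "nat^'d \<Rightarrow> nat \<Rightarrow> (real^'d \<Rightarrow> complex) set" where
  "Theta_sym \<beta> n = {t \<in> Theta \<beta> n. \<forall>\<xi>. t \<xi> = t (- \<xi>)}"

definition real_mat :: "int^'d^'d \<Rightarrow> real^'d^'d" where
  "real_mat M = map_matrix real_of_int M"

definition minv :: "int^'d^'d \<Rightarrow> real^'d^'d" where
  "minv M = matrix_inv (real_mat M)"

definition mstar :: "int^'d^'d \<Rightarrow> real^'d^'d" where
  "mstar M = transpose (real_mat M)"

definition complex_eigenvalue :: "int^'d^'d \<Rightarrow> complex \<Rightarrow> bool" where
  "complex_eigenvalue M z \<longleftrightarrow> (\<exists>v::complex^'d. v \<noteq> 0 \<and> map_matrix of_int M *v v = z *s v)"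

definition matrix_dilation :: "int^'d^'d \<Rightarrow> bool" where
  "matrix_dilation M \<longleftrightarrow> (\<forall>z. complex_eigenvalue M z \<longrightarrow> norm z > 1)"

definition dil_index :: "int^'d^'d \<Rightarrow> nat" where
  "dil_index M = nat \<bar>det M\<bar>"

definition digit_set :: "int^'d^'d \<Rightarrow> (nat \<Rightarrow> int^'d) \<Rightarrow> bool" where
  "digit_set M s \<longleftrightarrow> (\<forall>x. \<exists>!k. k < dil_index M \<and> (\<exists>y. x - s k = M *v y))"

definition is_mask :: "(real^'d \<Rightarrow> complex) \<Rightarrow> bool" where
  "is_mask m0 \<longleftrightarrow> trig_poly m0 \<and> m0 0 = 1"

definition polyphase_components ::
  "int^'d^'d \<Rightarrow> (nat \<Rightarrow> int^'d) \<Rightarrow> (real^'d \<Rightarrow> complex) \<Rightarrow> (nat \<Rightarrow> real^'d \<Rightarrow> complex) \<Rightarrow> bool" where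
  "polyphase_components M s m0 \<mu> \<longleftrightarrow>
     (\<forall>k<dil_index M. trig_poly (\<mu> k)) \<and>
     (\<forall>\<xi>. m0 \<xi> = 1 / of_real (sqrt (dil_index M)) *
        (\<Sum>k<dil_index M. char_exp (of_int_vec (s k)) \<xi> * \<mu> k (mstar M *v \<xi>)))"

definition partner :: "int^'d^'d \<Rightarrow> (nat \<Rightarrow> int^'d) \<Rightarrow> real^'d \<Rightarrow> nat \<Rightarrow> nat" where
  "partner M s c k = (THE l. l < dil_index M \<and>
     minv M *v (2 *\<^sub>R c - of_int_vec (s k) - of_int_vec (s l)) \<in> int_lattice)"

definition index_J :: "int^'d^'d \<Rightarrow> (nat \<Rightarrow> int^'d) \<Rightarrow> real^'d \<Rightarrow> nat set" where
  "index_J M s c = {k. k < dil_index M \<and> partner M s c k = k}"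

definition index_I :: "int^'d^'d \<Rightarrow> (nat \<Rightarrow> int^'d) \<Rightarrow> real^'d \<Rightarrow> nat set" where
  "index_I M s c = {k. k < dil_index M \<and> partner M s c k \<noteq> k}"

end

theory Submission
  imports Defs "HOL-Computational_Algebra.Polynomial"
begin

text \<open>
  All functions involved are finite exponential sums, and the derivatives of such a sum at the
  origin are, up to powers of \<open>2\<pi>i\<close>, the power sums of its frequencies: its moments. Moments are
  linear, reflection of the argument multiplies them by \<open>(-1)\<^bsup>[\<alpha>]\<^esup>\<close>, and multiplication by a
  character acts on them by the binomial theorem (\<open>exp_sums_shift\<close>).

  Moments of order less than \<open>n\<close> can be prescribed arbitrarily with frequencies in any coset of the
  integer lattice: in one variable this is the invertibility of the Vandermonde matrix
  (\<open>lagrange_dual_basis\<close>), and tensor products give the multivariate case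
  (\<open>exists_dual_exp_sum\<close>). If doubling maps the coset into the lattice and the prescribed
  moments vanish at odd multi-indices, the solution can be made even (\<open>exists_even_dual_exp_sum\<close>).

  The numbers required of the polyphase components simplify: composing the two binomial
  transforms, one with \<open>M\<^sup>-\<^sup>1c\<close> and one with \<open>-M\<^sup>-\<^sup>1s\<^sub>k\<close>, yields a single transform of \<open>lam'\<close> with
  \<open>M\<^sup>-\<^sup>1(c - s\<^sub>k)\<close> (\<open>umbral_composition\<close>). So the \<open>k\<close>-th component should have, up to the factor
  \<open>1/\<surd>m\<close>, the moments of \<open>t(\<xi>) e\<^bsup>2\<pi>i(M\<^sup>-\<^sup>1(c - s\<^sub>k),\<xi>)\<^esup>\<close> where \<open>t\<close> has moments \<open>lam'\<close>.
  Symmetry of the mask about \<open>c\<close> relates the components of partners \<open>k\<close> and \<open>l\<close>. If \<open>l = k\<close>, then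
  \<open>2M\<^sup>-\<^sup>1(c - s\<^sub>k)\<close> is integral, and an even \<open>t\<close> with frequencies in the coset of
  \<open>M\<^sup>-\<^sup>1(c - s\<^sub>k)\<close> satisfies the requirement; it exists because \<open>lam'\<close> vanishes at odd multi-indices.
  If \<open>l \<noteq> k\<close>, one of the two components may be any trigonometric polynomial with the required
  moments, and the other is its reflection. This is consistent with the prescribed moments because
  the shifts \<open>M\<^sup>-\<^sup>1(c - s\<^sub>k)\<close> and \<open>M\<^sup>-\<^sup>1(c - s\<^sub>l)\<close> are opposite and \<open>lam'\<close> vanishes at odd multi-indices
  (\<open>reflected_taylor_coefficient\<close>).
\<close>

section \<open>Exponential sums and their moments\<close>

definition exp_sums :: "(real^'d) set \<Rightarrow> (real^'d \<Rightarrow> complex) set" where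
  "exp_sums S = {f. \<exists>A h. finite A \<and> A \<subseteq> S \<and> f = (\<lambda>\<xi>. \<Sum>a\<in>A. h a * char_exp a \<xi>)}"

text \<open>The normalisation makes the character with frequency \<open>a\<close> have moments \<open>a\<^sup>\<alpha>\<close>, which turns
  every derivative at the origin into a power sum over the frequencies.\<close>

definition moment :: "(real^'d \<Rightarrow> complex) \<Rightarrow> nat^'d \<Rightarrow> complex" where
  "moment f \<alpha> = mixed_deriv \<alpha> f 0 / (2 * of_real pi * \<i>) ^ mi_size \<alpha>"

lemma mixed_deriv_eq_moment:
  "mixed_deriv \<alpha> f 0 = (2 * of_real pi * \<i>) ^ mi_size \<alpha> * moment f \<alpha>"
  by (simp add: moment_def)

lemma char_exp_add: "char_exp (a + b) \<xi> = char_exp a \<xi> * char_exp b \<xi>"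
  by (simp add: char_exp_def inner_add_left exp_add [symmetric] algebra_simps)

lemma char_exp_uminus: "char_exp a (- \<xi>) = char_exp (- a) \<xi>"
  by (simp add: char_exp_def)

lemma char_exp_at_0 [simp]: "char_exp a 0 = 1"
  by (simp add: char_exp_def)

lemma char_exp_transpose: "char_exp a (transpose A *v \<xi>) = char_exp (A *v a) \<xi>"
proof -
  have "a \<bullet> (transpose A *v \<xi>) = (A *v a) \<bullet> \<xi>"
    by (metis dot_lmul_matrix transpose_matrix_vector transpose_transpose)
  then show ?thesis
    by (simp add: char_exp_def)
qed

lemma partial_deriv_exp_sum:
  assumes "finite I"
  shows "partial_deriv j (\<lambda>\<xi>. \<Sum>i\<in>I. h i * char_exp (a i) \<xi>) =
    (\<lambda>\<xi>. \<Sum>i\<in>I. h i * (2 * of_real pi * \<i> * of_real (a i $ j)) * char_exp (a i) \<xi>)"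
proof
  fix \<xi>
  have "((\<lambda>t. \<Sum>i\<in>I. h i * char_exp (a i) (\<xi> + t *\<^sub>R axis j 1)) has_vector_derivative
     (\<Sum>i\<in>I. h i * (2 * of_real pi * \<i> * of_real (a i $ j)) * char_exp (a i) \<xi>)) (at 0)"
  proof (rule has_vector_derivative_sum)
    fix i
    have eq: "h i * char_exp (a i) (\<xi> + t *\<^sub>R axis j 1) =
        h i * char_exp (a i) \<xi> * exp (2 * of_real pi * \<i> * of_real (a i $ j) * of_real t)" for t
      by (simp add: char_exp_def inner_add_right inner_axis exp_add [symmetric] algebra_simps)
    show "((\<lambda>t. h i * char_exp (a i) (\<xi> + t *\<^sub>R axis j 1)) has_vector_derivative
      h i * (2 * of_real pi * \<i> * of_real (a i $ j)) * char_exp (a i) \<xi>) (at 0)"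
      unfolding eq
      by (rule has_vector_derivative_eq_rhs, rule has_vector_derivative_real_field)
         (auto intro!: derivative_eq_intros)
  qed
  then show "partial_deriv j (\<lambda>\<xi>. \<Sum>i\<in>I. h i * char_exp (a i) \<xi>) \<xi> =
     (\<Sum>i\<in>I. h i * (2 * of_real pi * \<i> * of_real (a i $ j)) * char_exp (a i) \<xi>)"
    unfolding partial_deriv_def by (rule vector_derivative_at)
qed

text \<open>Characters are eigenfunctions of every partial derivative, so each factor of the iterated
  derivative only rescales the coefficients. In particular the result is the same for every
  enumeration of the coordinates.\<close>

lemma mixed_deriv_exp_sum:
  fixes a :: "'i \<Rightarrow> real^'d"
  assumes "finite I"
  shows "mixed_deriv \<alpha> (\<lambda>\<xi>. \<Sum>i\<in>I. h i * char_exp (a i) \<xi>) =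
    (\<lambda>\<xi>. \<Sum>i\<in>I. h i * ((2 * of_real pi * \<i>) ^ mi_size \<alpha> * of_real (mi_power (a i) \<alpha>))
       * char_exp (a i) \<xi>)"
proof -
  have pow: "(partial_deriv j ^^ r) (\<lambda>\<xi>. \<Sum>i\<in>I. h i * char_exp (a i) \<xi>) =
      (\<lambda>\<xi>. \<Sum>i\<in>I. h i * (2 * of_real pi * \<i> * of_real (a i $ j)) ^ r * char_exp (a i) \<xi>)"
    for j r h
  proof (induction r)
    case (Suc r)
    show ?case
      unfolding funpow.simps o_apply Suc.IH partial_deriv_exp_sum [OF assms]
      by (simp only: power_Suc mult_ac)
  qed simp
  have fold: "foldr (\<lambda>j. partial_deriv j ^^ (\<alpha> $ j)) js (\<lambda>\<xi>. \<Sum>i\<in>I. h i * char_exp (a i) \<xi>) =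
      (\<lambda>\<xi>. \<Sum>i\<in>I. h i * (\<Prod>j\<in>set js. (2 * of_real pi * \<i> * of_real (a i $ j)) ^ (\<alpha> $ j))
         * char_exp (a i) \<xi>)"
    if "distinct js" for js
    using that
  proof (induction js)
    case (Cons j js)
    have IH: "foldr (\<lambda>j. partial_deriv j ^^ (\<alpha> $ j)) js (\<lambda>\<xi>. \<Sum>i\<in>I. h i * char_exp (a i) \<xi>) =
      (\<lambda>\<xi>. \<Sum>i\<in>I. h i * (\<Prod>j\<in>set js. (2 * of_real pi * \<i> * of_real (a i $ j)) ^ (\<alpha> $ j))
         * char_exp (a i) \<xi>)"
      using Cons by simp
    have prod: "(\<Prod>k\<in>set (j # js). g k) = g j * (\<Prod>k\<in>set js. g k)" for g :: "_ \<Rightarrow> complex"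
      using Cons.prems by simp
    show ?case
      unfolding foldr.simps o_apply IH pow prod by (simp only: mult_ac)
  qed simp
  obtain js where js: "js = (SOME js :: 'd list. distinct js \<and> set js = UNIV)" by blast
  have "distinct js \<and> set js = UNIV"
    unfolding js by (rule someI_ex) (use finite_distinct_list [OF finite_class.finite_UNIV] in blast)
  moreover have "(\<Prod>j\<in>UNIV. (2 * of_real pi * \<i> * of_real (a i $ j)) ^ (\<alpha> $ j)) =
      (2 * of_real pi * \<i>) ^ mi_size \<alpha> * of_real (mi_power (a i) \<alpha>)" for i
    by (simp only: mi_size_def mi_power_def power_mult_distrib prod.distrib power_sum
        of_real_prod of_real_power)
  ultimately show ?thesis
    using fold [of js] unfolding mixed_deriv_def js [symmetric] by simp
qed

lemma moment_exp_sum: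
  assumes "finite I"
  shows "moment (\<lambda>\<xi>. \<Sum>i\<in>I. h i * char_exp (a i) \<xi>) \<alpha> =
    (\<Sum>i\<in>I. h i * of_real (mi_power (a i) \<alpha>))"
proof -
  have "h i * ((2 * of_real pi * \<i>) ^ mi_size \<alpha> * of_real (mi_power (a i) \<alpha>)) * char_exp (a i) 0 =
      (2 * of_real pi * \<i>) ^ mi_size \<alpha> * (h i * of_real (mi_power (a i) \<alpha>))" for i
    by simp
  then show ?thesis
    unfolding moment_def mixed_deriv_exp_sum [OF assms] by (simp only: sum_distrib_left [symmetric]) simp
qed

text \<open>Frequencies may be listed with repetitions: the coefficients of equal frequencies are collected.\<close>

lemma exp_sum_in_exp_sums:
  assumes "finite I" "\<And>i. i \<in> I \<Longrightarrow> a i \<in> S"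
  shows "(\<lambda>\<xi>. \<Sum>i\<in>I. h i * char_exp (a i) \<xi>) \<in> exp_sums S"
proof -
  have "(\<lambda>\<xi>. \<Sum>i\<in>I. h i * char_exp (a i) \<xi>) =
      (\<lambda>\<xi>. \<Sum>x\<in>a ` I. (\<Sum>i | i \<in> I \<and> a i = x. h i) * char_exp x \<xi>)"
    by (subst sum.image_gen [OF assms(1), where g = a]) (simp add: sum_distrib_right)
  moreover have "finite (a ` I)" "a ` I \<subseteq> S"
    using assms by auto
  ultimately show ?thesis
    unfolding exp_sums_def by (intro CollectI exI conjI)
qed

lemma exp_sumsE:
  assumes "f \<in> exp_sums S"
  obtains A h where "finite A" "A \<subseteq> S" "f = (\<lambda>\<xi>. \<Sum>a\<in>A. h a * char_exp a \<xi>)"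
  using assms unfolding exp_sums_def by blast

lemma exp_sums_mono: "S \<subseteq> T \<Longrightarrow> f \<in> exp_sums S \<Longrightarrow> f \<in> exp_sums T"
  unfolding exp_sums_def by blast

lemma exp_sums_linear:
  assumes "finite J" "\<And>j. j \<in> J \<Longrightarrow> f j \<in> exp_sums S"
  shows exp_sums_lincomb: "(\<lambda>\<xi>. \<Sum>j\<in>J. u j * f j \<xi>) \<in> exp_sums S"
    and moment_lincomb: "moment (\<lambda>\<xi>. \<Sum>j\<in>J. u j * f j \<xi>) \<alpha> = (\<Sum>j\<in>J. u j * moment (f j) \<alpha>)"
proof -
  have "\<exists>A h. finite A \<and> A \<subseteq> S \<and> f j = (\<lambda>\<xi>. \<Sum>a\<in>A. h a * char_exp a \<xi>)" if "j \<in> J" for j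
    using assms(2) [OF that] unfolding exp_sums_def by blast
  then obtain A h where A: "\<And>j. j \<in> J \<Longrightarrow> finite (A j)" "\<And>j. j \<in> J \<Longrightarrow> A j \<subseteq> S"
      and f: "\<And>j. j \<in> J \<Longrightarrow> f j = (\<lambda>\<xi>. \<Sum>a\<in>A j. h j a * char_exp a \<xi>)"
    by metis
  let ?I = "SIGMA j:J. A j"
  have fin: "finite ?I"
    using assms(1) A(1) by blast
  have sum_Sigma: "(\<Sum>i\<in>?I. g i) = (\<Sum>j\<in>J. \<Sum>a\<in>A j. g (j, a))" for g :: "_ \<Rightarrow> complex"
    using assms(1) A(1) by (simp add: sum.Sigma)
  have eq: "(\<lambda>\<xi>. \<Sum>j\<in>J. u j * f j \<xi>) = (\<lambda>\<xi>. \<Sum>i\<in>?I. (u (fst i) * h (fst i) (snd i)) * char_exp (snd i) \<xi>)"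
    unfolding sum_Sigma by (simp add: f sum_distrib_left mult.assoc)
  show "(\<lambda>\<xi>. \<Sum>j\<in>J. u j * f j \<xi>) \<in> exp_sums S"
    unfolding eq using fin A(2) by (intro exp_sum_in_exp_sums) fastforce+
  show "moment (\<lambda>\<xi>. \<Sum>j\<in>J. u j * f j \<xi>) \<alpha> = (\<Sum>j\<in>J. u j * moment (f j) \<alpha>)"
    unfolding eq unfolding moment_exp_sum [OF fin] unfolding sum_Sigma
    by (simp add: f moment_exp_sum A(1) sum_distrib_left mult.assoc)
qed

text \<open>Both multi-indices below a bound and cubes of frequencies are boxes of vectors; over a box a sum
  of products splits into one-dimensional sums.\<close>

lemma vec_box:
  fixes F :: "'d::finite \<Rightarrow> 'b \<Rightarrow> 'c::comm_semiring_1"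
  assumes "\<And>j. finite (B j)"
  shows sum_vec_prod: "(\<Sum>v | \<forall>j. v $ j \<in> B j. \<Prod>j\<in>UNIV. F j (v $ j)) = (\<Prod>j\<in>UNIV. \<Sum>x\<in>B j. F j x)"
    and finite_vec_box: "finite {v :: 'b^'d. \<forall>j. v $ j \<in> B j}"
proof -
  have bij: "bij_betw (\<lambda>v. ($) v) {v :: 'b^'d. \<forall>j. v $ j \<in> B j} (PiE UNIV B)"
    by (rule bij_betw_byWitness [where f' = vec_lambda]) auto
  then show "finite {v :: 'b^'d. \<forall>j. v $ j \<in> B j}"
    using bij_betw_finite finite_PiE [of UNIV B] assms by fastforce
  show "(\<Sum>v | \<forall>j. v $ j \<in> B j. \<Prod>j\<in>UNIV. F j (v $ j)) = (\<Prod>j\<in>UNIV. \<Sum>x\<in>B j. F j x)"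
    using sum.reindex_bij_betw [OF bij, of "\<lambda>g. \<Prod>j\<in>UNIV. F j (g j)"]
    by (simp add: prod_sum_PiE assms)
qed

lemma atMost_vec: "{..\<beta>} = {\<alpha> :: nat^'d. \<forall>j. \<alpha> $ j \<in> {..\<beta> $ j}}"
  by (auto simp: less_eq_vec_def)

lemma finite_atMost_vec [simp]: "finite {..\<beta> :: nat^'d}"
  unfolding atMost_vec by (rule finite_vec_box) simp

lemma mi_binom_eq_prod: "\<alpha> \<le> \<beta> \<Longrightarrow> mi_binom \<beta> \<alpha> = (\<Prod>j\<in>UNIV. real (\<beta> $ j choose \<alpha> $ j))"
  by (simp add: mi_binom_def mi_fact_def less_eq_vec_def binomial_fact prod.distrib prod_dividef)

lemma mi_power_add:
  "mi_power (x + y) \<beta> = (\<Sum>\<alpha>\<le>\<beta>. mi_binom \<beta> \<alpha> * mi_power x \<alpha> * mi_power y (\<beta> - \<alpha>))"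
proof -
  have "mi_power (x + y) \<beta> =
      (\<Prod>j\<in>UNIV. \<Sum>r\<in>{..\<beta> $ j}. of_nat (\<beta> $ j choose r) * (x $ j) ^ r * (y $ j) ^ (\<beta> $ j - r))"
    by (simp add: mi_power_def binomial_ring)
  also have "\<dots> = (\<Sum>\<alpha>\<le>\<beta>. \<Prod>j\<in>UNIV. of_nat (\<beta> $ j choose \<alpha> $ j) * (x $ j) ^ (\<alpha> $ j) *
      (y $ j) ^ (\<beta> $ j - \<alpha> $ j))"
    unfolding atMost_vec by (rule sum_vec_prod [symmetric]) simp
  also have "\<dots> = (\<Sum>\<alpha>\<le>\<beta>. mi_binom \<beta> \<alpha> * mi_power x \<alpha> * mi_power y (\<beta> - \<alpha>))"
    by (rule sum.cong) (simp_all add: mi_binom_eq_prod mi_power_def prod.distrib)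
  finally show ?thesis .
qed

text \<open>Multiplication by a character translates the frequencies. The formula for the moments is the
  binomial theorem for \<open>(a + b)\<^sup>\<beta>\<close>, summed over the frequencies \<open>a\<close>; it is the Leibniz rule at the
  origin.\<close>

lemma exp_sums_shift:
  assumes "f \<in> exp_sums S"
  shows exp_sums_mult_char_exp: "(\<lambda>\<xi>. f \<xi> * char_exp b \<xi>) \<in> exp_sums ((\<lambda>a. a + b) ` S)"
    and moment_mult_char_exp: "moment (\<lambda>\<xi>. f \<xi> * char_exp b \<xi>) \<beta> =
      (\<Sum>\<alpha>\<le>\<beta>. moment f \<alpha> * of_real (mi_binom \<beta> \<alpha> * mi_power b (\<beta> - \<alpha>)))"
proof -
  obtain A h where A: "finite A" "A \<subseteq> S" and f: "f = (\<lambda>\<xi>. \<Sum>a\<in>A. h a * char_exp a \<xi>)"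
    using assms by (rule exp_sumsE)
  have eq: "(\<lambda>\<xi>. f \<xi> * char_exp b \<xi>) = (\<lambda>\<xi>. \<Sum>a\<in>A. h a * char_exp (a + b) \<xi>)"
    by (simp add: f char_exp_add sum_distrib_right mult.assoc)
  show "(\<lambda>\<xi>. f \<xi> * char_exp b \<xi>) \<in> exp_sums ((\<lambda>a. a + b) ` S)"
    unfolding eq using A by (intro exp_sum_in_exp_sums) auto
  have "moment (\<lambda>\<xi>. f \<xi> * char_exp b \<xi>) \<beta> = (\<Sum>a\<in>A. \<Sum>\<alpha>\<le>\<beta>. h a * of_real (mi_power a \<alpha>) *
       of_real (mi_binom \<beta> \<alpha> * mi_power b (\<beta> - \<alpha>)))"
    unfolding eq moment_exp_sum [OF A(1)] mi_power_add of_real_sum of_real_mult sum_distrib_left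
    by (simp only: mult_ac)
  also have "\<dots> = (\<Sum>\<alpha>\<le>\<beta>. moment f \<alpha> * of_real (mi_binom \<beta> \<alpha> * mi_power b (\<beta> - \<alpha>)))"
    unfolding f moment_exp_sum [OF A(1)] sum_distrib_right by (rule sum.swap)
  finally show "moment (\<lambda>\<xi>. f \<xi> * char_exp b \<xi>) \<beta> =
      (\<Sum>\<alpha>\<le>\<beta>. moment f \<alpha> * of_real (mi_binom \<beta> \<alpha> * mi_power b (\<beta> - \<alpha>)))" .
qed

lemma mi_power_uminus: "mi_power (- a) \<alpha> = (- 1) ^ mi_size \<alpha> * mi_power a \<alpha>"
proof -
  have "mi_power (- a) \<alpha> = (\<Prod>j\<in>UNIV. (- 1) ^ (\<alpha> $ j) * (a $ j) ^ (\<alpha> $ j))"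
    unfolding mi_power_def vector_uminus_component
    by (rule prod.cong [OF refl]) (rule power_minus)
  then show ?thesis
    by (simp only: mi_power_def mi_size_def prod.distrib power_sum)
qed

lemma exp_sums_reflect:
  assumes "f \<in> exp_sums S"
  shows exp_sums_comp_uminus: "(\<lambda>\<xi>. f (- \<xi>)) \<in> exp_sums (uminus ` S)"
    and moment_comp_uminus: "moment (\<lambda>\<xi>. f (- \<xi>)) \<alpha> = (- 1) ^ mi_size \<alpha> * moment f \<alpha>"
proof -
  obtain A h where A: "finite A" "A \<subseteq> S" and f: "f = (\<lambda>\<xi>. \<Sum>a\<in>A. h a * char_exp a \<xi>)"
    using assms by (rule exp_sumsE)
  have eq: "(\<lambda>\<xi>. f (- \<xi>)) = (\<lambda>\<xi>. \<Sum>a\<in>A. h a * char_exp (- a) \<xi>)"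
    by (simp add: f char_exp_uminus)
  show "(\<lambda>\<xi>. f (- \<xi>)) \<in> exp_sums (uminus ` S)"
    unfolding eq using A by (intro exp_sum_in_exp_sums) blast+
  show "moment (\<lambda>\<xi>. f (- \<xi>)) \<alpha> = (- 1) ^ mi_size \<alpha> * moment f \<alpha>"
    unfolding eq moment_exp_sum [OF A(1)]
    unfolding f moment_exp_sum [OF A(1)] mi_power_uminus sum_distrib_left
    by (simp add: mult.left_commute)
qed

lemma exp_sums_comp_transpose:
  assumes "f \<in> exp_sums S"
  shows "(\<lambda>\<xi>. f (transpose A *v \<xi>)) \<in> exp_sums ((*v) A ` S)"
proof -
  obtain B h where B: "finite B" "B \<subseteq> S" and f: "f = (\<lambda>\<xi>. \<Sum>a\<in>B. h a * char_exp a \<xi>)"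
    using assms by (rule exp_sumsE)
  show ?thesis
    unfolding f char_exp_transpose using B by (intro exp_sum_in_exp_sums) blast+
qed

lemma moment_0: "moment f 0 = f 0"
proof -
  have "foldr (\<lambda>j. partial_deriv j ^^ (0 $ j)) js f = f" for js :: "'a list" and f :: "real^'a \<Rightarrow> complex"
    by (induction js) auto
  then show ?thesis
    by (simp add: moment_def mi_size_def mixed_deriv_def)
qed

lemma semi_trig_poly_iff_exp_sums:
  "semi_trig_poly \<sigma> t \<longleftrightarrow> \<sigma> \<in> semi_degrees \<and> t \<in> exp_sums (range (\<lambda>k. of_int_vec k + \<sigma>))"
proof -
  have inj: "inj (\<lambda>k. of_int_vec k + \<sigma>)"
    by (auto simp: inj_on_def of_int_vec_def vec_eq_iff)
  have "t \<in> exp_sums (range (\<lambda>k. of_int_vec k + \<sigma>))"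
    if "finite K" "\<forall>\<xi>. t \<xi> = (\<Sum>k\<in>K. h k * char_exp (of_int_vec k + \<sigma>) \<xi>)" for K h
  proof -
    have "t = (\<lambda>\<xi>. \<Sum>k\<in>K. h k * char_exp (of_int_vec k + \<sigma>) \<xi>)"
      using that(2) by auto
    then show ?thesis
      using that(1) by (auto intro: exp_sum_in_exp_sums)
  qed
  moreover have "\<exists>K h. finite K \<and> (\<forall>\<xi>. t \<xi> = (\<Sum>k\<in>K. h k * char_exp (of_int_vec k + \<sigma>) \<xi>))"
    if t: "t \<in> exp_sums (range (\<lambda>k. of_int_vec k + \<sigma>))"
  proof -
    obtain A h where A: "finite A" "A \<subseteq> range (\<lambda>k. of_int_vec k + \<sigma>)"
        and f: "t = (\<lambda>\<xi>. \<Sum>a\<in>A. h a * char_exp a \<xi>)"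
      using t by (rule exp_sumsE)
    then obtain K where "finite K" and K: "A = (\<lambda>k. of_int_vec k + \<sigma>) ` K"
      by (meson finite_subset_image)
    have "\<forall>\<xi>. t \<xi> = (\<Sum>k\<in>K. h (of_int_vec k + \<sigma>) * char_exp (of_int_vec k + \<sigma>) \<xi>)"
      unfolding f K by (simp add: sum.reindex inj_on_subset [OF inj])
    with \<open>finite K\<close> show ?thesis
      by (intro exI conjI)
  qed
  ultimately show ?thesis
    unfolding semi_trig_poly_def by blast
qed

lemma trig_poly_iff_exp_sums: "trig_poly t \<longleftrightarrow> t \<in> exp_sums int_lattice"
proof -
  have "(0 :: real^'a) \<in> semi_degrees"
    by (auto simp: semi_degrees_def half_int_lattice_def int_lattice_def of_int_vec_def vec_eq_iff
        intro!: rev_image_eqI [of 0])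
  then show ?thesis
    by (simp add: semi_trig_poly_iff_exp_sums int_lattice_def)
qed

section \<open>Trigonometric polynomials with prescribed derivatives at the origin\<close>

lemma exp_sums_scaled:
  assumes "f \<in> exp_sums S"
  shows exp_sums_scale: "(\<lambda>\<xi>. u * f \<xi>) \<in> exp_sums S"
    and moment_scale: "moment (\<lambda>\<xi>. u * f \<xi>) \<alpha> = u * moment f \<alpha>"
  using exp_sums_linear [of "{()}" "\<lambda>_. f" S "\<lambda>_. u"] assms by simp_all

text \<open>The coefficients of the Lagrange basis polynomials \<open>L\<^sub>k\<close> of the nodes invert the Vandermonde
  matrix: interpolation reproduces the monomial \<open>X\<^sup>a\<close>, and comparing coefficients in
  \<open>\<Sum>\<^sub>k x\<^sub>k\<^sup>a L\<^sub>k = X\<^sup>a\<close> gives the claim.\<close>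

lemma lagrange_dual_basis:
  fixes x :: "nat \<Rightarrow> real"
  assumes "inj_on x {..<n}"
  shows "\<exists>h. \<forall>a<n. \<forall>b<n. (\<Sum>k<n. h b k * x k ^ a) = (if a = b then 1 else 0)"
proof -
  define L where "L k = (\<Prod>i\<in>{..<n} - {k}. smult (1 / (x k - x i)) [:- x i, 1:])" for k
  have val: "poly (L k) (x l) = (if k = l then 1 else 0)" if "k < n" "l < n" for k l
  proof (cases "k = l")
    case True
    have "poly (smult (1 / (x k - x i)) [:- x i, 1:]) (x k) = 1" if "i \<in> {..<n} - {k}" for i
    proof -
      have "x k - x i \<noteq> 0"
        using that \<open>k < n\<close> assms by (auto dest: inj_onD)
      then show ?thesis
        by (simp add: diff_divide_distrib [symmetric])
    qed
    with True show ?thesis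
      by (simp only: L_def poly_prod prod.neutral if_True) simp
  next
    case False
    then have "poly (smult (1 / (x k - x l)) [:- x l, 1:]) (x l) = 0" "l \<in> {..<n} - {k}"
      using that by auto
    then have "poly (L k) (x l) = 0"
      unfolding L_def poly_prod by (intro prod_zero) blast+
    with False show ?thesis by simp
  qed
  have deg: "degree (L k) < n" if "k < n" for k
  proof -
    have "degree (L k) \<le> (\<Sum>i\<in>{..<n} - {k}. degree (smult (1 / (x k - x i)) [:- x i, 1:]))"
      unfolding L_def
      by (rule order.trans [OF degree_prod_sum_le])
        (simp_all only: o_def finite_Diff finite_lessThan order_refl)
    also have "\<dots> \<le> (\<Sum>i\<in>{..<n} - {k}. 1)"
      by (intro sum_mono order.trans [OF degree_smult_le]) simp
    also have "\<dots> < n"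
      using that by simp
    finally show ?thesis .
  qed
  have "(\<Sum>k<n. coeff (L k) b * x k ^ a) = (if a = b then 1 else 0)" if "a < n" for a b
  proof -
    have "(\<Sum>k<n. smult (x k ^ a) (L k)) = monom 1 a"
    proof (rule poly_eqI_degree [where A = "x ` {..<n}"])
      fix y assume "y \<in> x ` {..<n}"
      then obtain l where "l < n" "y = x l" by blast
      then have "poly (\<Sum>k<n. smult (x k ^ a) (L k)) y = (\<Sum>k<n. if k = l then x k ^ a else 0)"
        unfolding poly_sum by (intro sum.cong) (simp_all add: val)
      then show "poly (\<Sum>k<n. smult (x k ^ a) (L k)) y = poly (monom 1 a) y"
        using \<open>l < n\<close> \<open>y = x l\<close> by (simp add: poly_monom)
    next
      have "degree (\<Sum>k<n. smult (x k ^ a) (L k)) \<le> n - 1"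
        using deg by (intro degree_sum_le order.trans [OF degree_smult_le]) fastforce+
      then show "degree (\<Sum>k<n. smult (x k ^ a) (L k)) < card (x ` {..<n})"
        using that by (simp add: card_image [OF assms])
      show "degree (monom (1 :: real) a) < card (x ` {..<n})"
        using that by (simp add: card_image [OF assms] degree_monom_eq)
    qed
    then have "coeff (\<Sum>k<n. smult (x k ^ a) (L k)) b = (if a = b then 1 else 0)"
      by simp
    then show ?thesis
      by (simp add: coeff_sum mult.commute)
  qed
  then show ?thesis
    by (intro exI [of _ "\<lambda>b k. coeff (L k) b"]) blast
qed

lemma Delta_component_less: "\<alpha> \<in> Delta n \<Longrightarrow> \<alpha> $ j < n"
proof -
  have "\<alpha> $ j \<le> mi_size \<alpha>"
    unfolding mi_size_def by (rule member_le_sum) auto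
  then show "\<alpha> \<in> Delta n \<Longrightarrow> \<alpha> $ j < n"
    by (simp add: Delta_def)
qed

lemma finite_Delta [simp]: "finite (Delta n)"
proof (rule finite_subset)
  show "Delta n \<subseteq> {\<alpha>. \<forall>j. \<alpha> $ j \<in> {..<n}}"
    by (auto simp: Delta_component_less)
qed (rule finite_vec_box, simp)

lemma mi_size_mono: "\<alpha> \<le> \<beta> \<Longrightarrow> mi_size \<alpha> \<le> mi_size \<beta>"
  by (auto simp: mi_size_def less_eq_vec_def intro: sum_mono)

lemma Delta_down: "\<alpha> \<le> \<beta> \<Longrightarrow> \<beta> \<in> Delta n \<Longrightarrow> \<alpha> \<in> Delta n"
  using mi_size_mono [of \<alpha> \<beta>] by (simp add: Delta_def)

text \<open>A tensor product of one-dimensional solutions, with frequencies in the cube \<open>{0,\<dots>,n-1}\<^sup>d + \<sigma>\<close>.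
  Its moments factor over the coordinates, and a multi-index of size less than \<open>n\<close> has all entries
  less than \<open>n\<close>, so each factor is a Kronecker delta.\<close>

lemma exists_dual_exp_sum:
  fixes \<sigma> :: "real^'d"
  assumes "\<beta> \<in> Delta n"
  shows "\<exists>t \<in> exp_sums (range (\<lambda>k. of_int_vec k + \<sigma>)).
    \<forall>\<alpha>\<in>Delta n. moment t \<alpha> = (if \<alpha> = \<beta> then 1 else 0)"
proof -
  have "\<exists>h. \<forall>a<n. \<forall>b<n. (\<Sum>k<n. h b k * (real k + \<sigma> $ j) ^ a) = (if a = b then 1 else 0)" for j
    by (rule lagrange_dual_basis) (auto simp: inj_on_def)
  then obtain h where h: "\<And>j a b. a < n \<Longrightarrow> b < n \<Longrightarrow>
      (\<Sum>k<n. h j b k * (real k + \<sigma> $ j) ^ a) = (if a = b then 1 else 0)"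
    by metis
  let ?K = "{v :: nat^'d. \<forall>j. v $ j \<in> {..<n}}"
  let ?freq = "\<lambda>v :: nat^'d. of_int_vec (\<chi> j. int (v $ j)) + \<sigma>"
  define t where "t = (\<lambda>\<xi>. \<Sum>v\<in>?K. of_real (\<Prod>j\<in>UNIV. h j (\<beta> $ j) (v $ j)) * char_exp (?freq v) \<xi>)"
  have fin: "finite ?K"
    by (rule finite_vec_box) simp
  have t: "t \<in> exp_sums (range (\<lambda>k. of_int_vec k + \<sigma>))"
    unfolding t_def by (rule exp_sum_in_exp_sums [OF fin]) blast
  have "moment t \<alpha> = (if \<alpha> = \<beta> then 1 else 0)" if "\<alpha> \<in> Delta n" for \<alpha>
  proof -
    have "moment t \<alpha> = of_real (\<Sum>v\<in>?K. \<Prod>j\<in>UNIV. h j (\<beta> $ j) (v $ j) * (real (v $ j) + \<sigma> $ j) ^ (\<alpha> $ j))"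
      unfolding t_def moment_exp_sum [OF fin]
      by (simp add: mi_power_def of_int_vec_def prod.distrib)
    also have "(\<Sum>v\<in>?K. \<Prod>j\<in>UNIV. h j (\<beta> $ j) (v $ j) * (real (v $ j) + \<sigma> $ j) ^ (\<alpha> $ j)) =
        (\<Prod>j\<in>UNIV. \<Sum>k<n. h j (\<beta> $ j) k * (real k + \<sigma> $ j) ^ (\<alpha> $ j))"
      by (rule sum_vec_prod) simp
    also have "\<dots> = (\<Prod>j\<in>UNIV. if \<alpha> $ j = \<beta> $ j then 1 else 0)"
      using that assms by (simp add: h Delta_component_less)
    also have "\<dots> = (if \<alpha> = \<beta> then 1 else 0)"
      by (auto simp: vec_eq_iff)
    finally show ?thesis by simp
  qed
  with t show ?thesis by blast
qed

lemma exists_dual_family: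
  fixes \<sigma> :: "real^'d"
  obtains g where "\<And>\<beta>. \<beta> \<in> Delta n \<Longrightarrow> g \<beta> \<in> exp_sums (range (\<lambda>k. of_int_vec k + \<sigma>))"
    "\<And>\<beta>. \<beta> \<in> Delta n \<Longrightarrow> \<forall>\<alpha>\<in>Delta n. moment (g \<beta>) \<alpha> = (if \<alpha> = \<beta> then 1 else 0)"
proof -
  have ex: "\<forall>\<beta>\<in>Delta n. \<exists>g. g \<in> exp_sums (range (\<lambda>k. of_int_vec k + \<sigma>)) \<and>
      (\<forall>\<alpha>\<in>Delta n. moment g \<alpha> = (if \<alpha> = \<beta> then 1 else 0))"
    using exists_dual_exp_sum [of _ n \<sigma>] by blast
  show thesis
    using bchoice [OF ex] by (elim exE) (rule that, blast+)
qed

lemma of_int_vec_simps: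
  "of_int_vec 0 = 0" "of_int_vec (x + y) = of_int_vec x + of_int_vec y"
  "of_int_vec (x - y) = of_int_vec x - of_int_vec y" "of_int_vec (- x) = - of_int_vec x"
  by (simp_all add: of_int_vec_def vec_eq_iff)

lemma of_int_vec_eq_iff [simp]: "of_int_vec x = of_int_vec y \<longleftrightarrow> x = y"
  by (simp add: of_int_vec_def vec_eq_iff)

lemma of_int_vec_in_lattice [simp]: "of_int_vec x \<in> int_lattice"
  by (simp add: int_lattice_def)

lemma int_lattice_0 [simp]: "0 \<in> int_lattice"
  by (metis of_int_vec_simps(1) of_int_vec_in_lattice)

lemma int_lattice_add: "x \<in> int_lattice \<Longrightarrow> y \<in> int_lattice \<Longrightarrow> x + y \<in> int_lattice"
  by (auto simp: int_lattice_def of_int_vec_simps(2) [symmetric])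

lemma int_lattice_diff: "x \<in> int_lattice \<Longrightarrow> y \<in> int_lattice \<Longrightarrow> x - y \<in> int_lattice"
  by (auto simp: int_lattice_def of_int_vec_simps(3) [symmetric])

lemma int_lattice_uminus: "x \<in> int_lattice \<Longrightarrow> - x \<in> int_lattice"
  using int_lattice_diff [of 0 x] by simp

lemma mem_lattice_coset: "x \<in> range (\<lambda>k. of_int_vec k + \<sigma>) \<longleftrightarrow> x - \<sigma> \<in> int_lattice"
  by (auto simp: int_lattice_def image_iff algebra_simps)

text \<open>The even part of a solution is again a solution, because reflection multiplies the moment of
  order \<open>\<alpha>\<close> by \<open>(-1)\<^bsup>[\<alpha>]\<^esup>\<close> and \<open>[\<beta>]\<close> is even. Reflection preserves the frequency coset of \<open>\<sigma>\<close>
  precisely when \<open>2\<sigma>\<close> is integral.\<close>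

lemma exists_even_dual_exp_sum:
  fixes \<sigma> :: "real^'d"
  assumes "\<beta> \<in> Delta_even n" "2 *\<^sub>R \<sigma> \<in> int_lattice"
  shows "\<exists>t \<in> exp_sums (range (\<lambda>k. of_int_vec k + \<sigma>)).
    (\<forall>\<xi>. t (- \<xi>) = t \<xi>) \<and> (\<forall>\<alpha>\<in>Delta n. moment t \<alpha> = (if \<alpha> = \<beta> then 1 else 0))"
proof -
  let ?S = "range (\<lambda>k. of_int_vec k + \<sigma>)"
  have \<beta>: "\<beta> \<in> Delta n" "even (mi_size \<beta>)"
    using assms by (simp_all add: Delta_even_def)
  then obtain t where t: "t \<in> exp_sums ?S"
      and mom: "\<And>\<alpha>. \<alpha> \<in> Delta n \<Longrightarrow> moment t \<alpha> = (if \<alpha> = \<beta> then 1 else 0)"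
    using exists_dual_exp_sum [of \<beta> n \<sigma>] by blast
  have "- x \<in> ?S" if "x \<in> ?S" for x
  proof -
    have "- x - \<sigma> = - ((x - \<sigma>) + 2 *\<^sub>R \<sigma>)"
      by (simp add: scaleR_2)
    with that assms(2) show ?thesis
      unfolding mem_lattice_coset by (simp only: int_lattice_add int_lattice_uminus)
  qed
  then have "(\<lambda>\<xi>. t (- \<xi>)) \<in> exp_sums ?S"
    using exp_sums_mono [OF _ exp_sums_comp_uminus [OF t], of ?S] by blast
  with t have f: "(if b then t else (\<lambda>\<xi>. t (- \<xi>))) \<in> exp_sums ?S" for b
    by simp
  let ?u = "\<lambda>\<xi>. \<Sum>b\<in>UNIV. 1 / 2 * (if b then t else (\<lambda>\<xi>. t (- \<xi>))) \<xi>"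
  show ?thesis
  proof (intro bexI [of _ ?u] conjI allI ballI)
    show "?u \<in> exp_sums ?S"
      by (rule exp_sums_lincomb [OF _ f]) simp
    show "?u (- \<xi>) = ?u \<xi>" for \<xi>
      by (simp add: UNIV_bool)
    fix \<alpha> :: "nat^'d" assume "\<alpha> \<in> Delta n"
    moreover have "moment ?u \<alpha> = (\<Sum>b\<in>UNIV. 1 / 2 * moment (if b then t else (\<lambda>\<xi>. t (- \<xi>))) \<alpha>)"
      by (rule moment_lincomb [OF _ f]) simp
    ultimately show "moment ?u \<alpha> = (if \<alpha> = \<beta> then 1 else 0)"
      using \<beta> by (simp add: UNIV_bool moment_comp_uminus [OF t] mom)
  qed
qed

lemma mem_Theta_iff:
  "t \<in> Theta \<beta> n \<longleftrightarrow> (\<exists>\<sigma>. semi_trig_poly \<sigma> t) \<and>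
     (\<forall>\<alpha>\<in>Delta n. moment t \<alpha> = (if \<alpha> = \<beta> then 1 else 0))"
  by (simp add: Theta_def mixed_deriv_eq_moment)

text \<open>Duality is demanded only where the coefficient is nonzero, since even interpolants do not exist
  for odd \<open>[\<beta>]\<close>.\<close>

lemma moment_dual_lincomb:
  fixes u :: "nat^'d \<Rightarrow> complex"
  assumes g: "\<And>\<beta>. \<beta> \<in> Delta n \<Longrightarrow> g \<beta> \<in> exp_sums S"
    and dual: "\<And>\<beta>. \<beta> \<in> Delta n \<Longrightarrow> u \<beta> \<noteq> 0 \<Longrightarrow>
      \<forall>\<alpha>\<in>Delta n. moment (g \<beta>) \<alpha> = (if \<alpha> = \<beta> then 1 else 0)"
    and \<alpha>: "\<alpha> \<in> Delta n"
  shows "moment (\<lambda>\<xi>. \<Sum>\<beta>\<in>Delta n. u \<beta> * g \<beta> \<xi>) \<alpha> = u \<alpha>"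
proof -
  have "moment (\<lambda>\<xi>. \<Sum>\<beta>\<in>Delta n. u \<beta> * g \<beta> \<xi>) \<alpha> = (\<Sum>\<beta>\<in>Delta n. u \<beta> * moment (g \<beta>) \<alpha>)"
    by (rule moment_lincomb [OF finite_Delta g])
  also have "\<dots> = (\<Sum>\<beta>\<in>Delta n. if \<alpha> = \<beta> then u \<beta> else 0)"
  proof (rule sum.cong [OF refl])
    fix \<beta> :: "nat^'d" assume "\<beta> \<in> Delta n"
    then show "u \<beta> * moment (g \<beta>) \<alpha> = (if \<alpha> = \<beta> then u \<beta> else 0)"
      using dual [of \<beta>] \<alpha> by (cases "u \<beta> = 0") simp_all
  qed
  finally show ?thesis
    using \<alpha> by simp
qed

text \<open>Both sides are the moments of \<open>t(\<xi>) e\<^bsup>2\<pi>i(u+v,\<xi>)\<^esup>\<close>, where \<open>t\<close> is any exponential sum with moments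
  \<open>lam'\<close> in orders below \<open>n\<close>: on the left the character is multiplied in two steps. No identity
  for products of binomial coefficients has to be manipulated.\<close>

lemma umbral_composition:
  fixes lam lam' :: "nat^'d \<Rightarrow> complex"
  assumes lam: "\<And>\<alpha>. \<alpha> \<in> Delta n \<Longrightarrow> lam \<alpha> =
      (\<Sum>\<gamma>\<le>\<alpha>. lam' \<gamma> * of_real (mi_binom \<alpha> \<gamma> * mi_power u (\<alpha> - \<gamma>)))"
    and \<beta>: "\<beta> \<in> Delta n"
  shows "(\<Sum>\<alpha>\<le>\<beta>. lam \<alpha> * of_real (mi_binom \<beta> \<alpha> * mi_power v (\<beta> - \<alpha>))) =
    (\<Sum>\<gamma>\<le>\<beta>. lam' \<gamma> * of_real (mi_binom \<beta> \<gamma> * mi_power (u + v) (\<beta> - \<gamma>)))"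
proof -
  obtain g where g:
      "\<And>\<beta>. \<beta> \<in> Delta n \<Longrightarrow> g \<beta> \<in> exp_sums (range (\<lambda>k. of_int_vec k + (0 :: real^'d)))"
      "\<And>\<beta>. \<beta> \<in> Delta n \<Longrightarrow> \<forall>\<alpha>\<in>Delta n. moment (g \<beta>) \<alpha> = (if \<alpha> = \<beta> then 1 else 0)"
    by (rule exists_dual_family [of n "0 :: real^'d"]) (rule that)
  define t where "t = (\<lambda>\<xi>. \<Sum>\<beta>\<in>Delta n. lam' \<beta> * g \<beta> \<xi>)"
  have t: "t \<in> exp_sums (range (\<lambda>k. of_int_vec k + 0))"
    unfolding t_def by (rule exp_sums_lincomb [OF finite_Delta g(1)])
  have mom: "moment t \<alpha> = lam' \<alpha>" if "\<alpha> \<in> Delta n" for \<alpha>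
    unfolding t_def by (rule moment_dual_lincomb [OF g that])
  have shift: "moment (\<lambda>\<xi>. t \<xi> * char_exp w \<xi>) \<alpha> =
      (\<Sum>\<gamma>\<le>\<alpha>. lam' \<gamma> * of_real (mi_binom \<alpha> \<gamma> * mi_power w (\<alpha> - \<gamma>)))" if "\<alpha> \<in> Delta n" for w \<alpha>
    unfolding moment_mult_char_exp [OF t]
    by (intro sum.cong refl) (simp add: mom Delta_down [OF _ that])
  have "(\<Sum>\<alpha>\<le>\<beta>. lam \<alpha> * of_real (mi_binom \<beta> \<alpha> * mi_power v (\<beta> - \<alpha>))) =
      (\<Sum>\<alpha>\<le>\<beta>. moment (\<lambda>\<xi>. t \<xi> * char_exp u \<xi>) \<alpha> * of_real (mi_binom \<beta> \<alpha> * mi_power v (\<beta> - \<alpha>)))"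
    by (intro sum.cong refl) (simp add: lam shift Delta_down [OF _ \<beta>])
  also have "\<dots> = moment (\<lambda>\<xi>. (t \<xi> * char_exp u \<xi>) * char_exp v \<xi>) \<beta>"
    by (rule moment_mult_char_exp [OF exp_sums_mult_char_exp [OF t], symmetric])
  also have "\<dots> = moment (\<lambda>\<xi>. t \<xi> * char_exp (u + v) \<xi>) \<beta>"
    by (simp only: char_exp_add mult.assoc)
  finally show ?thesis
    by (simp only: shift [OF \<beta>])
qed

section \<open>Dilations and digits\<close>

text \<open>A singular matrix has the eigenvalue 0, which is not bigger than 1 in modulus.\<close>

lemma dilation_det_nonzero:
  fixes M :: "int^'d^'d"
  assumes "matrix_dilation M"
  shows "det M \<noteq> 0"
proof
  assume "det M = 0"
  have "det (map_matrix of_int M :: complex^'d^'d) = of_int (det M)"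
    by (simp add: det_def)
  with \<open>det M = 0\<close> have "\<not> invertible (map_matrix of_int M :: complex^'d^'d)"
    by (simp add: invertible_det_nz)
  then obtain v :: "complex^'d" where "map_matrix of_int M *v v = 0" "v \<noteq> 0"
    unfolding invertible_left_inverse matrix_left_invertible_ker by blast
  then have "complex_eigenvalue M 0"
    unfolding complex_eigenvalue_def by (intro exI [of _ v]) simp
  with assms show False
    unfolding matrix_dilation_def by force
qed

lemma minv_inverse:
  fixes M :: "int^'d^'d"
  assumes "det M \<noteq> 0"
  shows real_mat_minv: "real_mat M *v (minv M *v x) = x"
    and minv_real_mat: "minv M *v (real_mat M *v x) = x"
proof -
  have "det (real_mat M) = of_int (det M)"
    by (simp add: det_def real_mat_def)
  with assms have "\<exists>B. real_mat M ** B = mat 1 \<and> B ** real_mat M = mat 1"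
    using invertible_det_nz [of "real_mat M"] by (simp add: invertible_def)
  then have "real_mat M ** minv M = mat 1 \<and> minv M ** real_mat M = mat 1"
    unfolding minv_def matrix_inv_def by (rule someI_ex)
  then show "real_mat M *v (minv M *v x) = x" "minv M *v (real_mat M *v x) = x"
    by (simp_all add: matrix_vector_mul_assoc)
qed

lemma real_mat_of_int_vec: "real_mat M *v of_int_vec x = of_int_vec (M *v x)"
  by (simp add: real_mat_def of_int_vec_def matrix_vector_mult_def vec_eq_iff)

lemma minv_in_lattice_iff:
  assumes "det M \<noteq> 0"
  shows "minv M *v of_int_vec z \<in> int_lattice \<longleftrightarrow> (\<exists>y. z = M *v y)"
proof
  assume "minv M *v of_int_vec z \<in> int_lattice"
  then obtain y where "minv M *v of_int_vec z = of_int_vec y"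
    by (auto simp: int_lattice_def)
  then have "of_int_vec z = of_int_vec (M *v y)"
    by (metis assms real_mat_minv real_mat_of_int_vec)
  then show "\<exists>y. z = M *v y" by auto
next
  assume "\<exists>y. z = M *v y"
  then show "minv M *v of_int_vec z \<in> int_lattice"
    by (auto simp: real_mat_of_int_vec [symmetric] minv_real_mat [OF assms])
qed

lemma char_exp_mstar: "char_exp a (mstar M *v \<xi>) = char_exp (real_mat M *v a) \<xi>"
  unfolding mstar_def by (rule char_exp_transpose)

lemma char_exp_minv_mstar:
  "det M \<noteq> 0 \<Longrightarrow> char_exp (minv M *v a) (mstar M *v \<xi>) = char_exp a \<xi>"
  by (simp add: char_exp_mstar real_mat_minv)

text \<open>The partner of \<open>k\<close> is the index of the digit that represents the coset of the integer vector
  \<open>2c - s\<^sub>k\<close>.\<close>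

lemma partner_unique:
  assumes "det M \<noteq> 0" "digit_set M s" "c \<in> half_int_lattice"
  shows "\<exists>!l. l < dil_index M \<and>
    minv M *v (2 *\<^sub>R c - of_int_vec (s k) - of_int_vec (s l)) \<in> int_lattice"
proof -
  obtain w where w: "2 *\<^sub>R c = of_int_vec w"
    using assms(3) by (auto simp: half_int_lattice_def int_lattice_def)
  show ?thesis
    unfolding w of_int_vec_simps [symmetric] minv_in_lattice_iff [OF assms(1)]
    using assms(2) unfolding digit_set_def by blast
qed

lemma partner:
  assumes "det M \<noteq> 0" "digit_set M s" "c \<in> half_int_lattice"
  shows partner_less: "partner M s c k < dil_index M"
    and partner_lattice:
      "minv M *v (2 *\<^sub>R c - of_int_vec (s k) - of_int_vec (s (partner M s c k))) \<in> int_lattice"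
  using theI' [OF partner_unique [OF assms, of k]] unfolding partner_def by blast+

text \<open>The defining condition is symmetric in the two indices.\<close>

lemma partner_partner:
  assumes "det M \<noteq> 0" "digit_set M s" "c \<in> half_int_lattice" "k < dil_index M"
  shows "partner M s c (partner M s c k) = k"
proof -
  have "minv M *v (2 *\<^sub>R c - of_int_vec (s (partner M s c k)) - of_int_vec (s k)) \<in> int_lattice"
    using partner_lattice [OF assms(1-3), of k] by (simp add: algebra_simps)
  then show ?thesis
    using partner_unique [OF assms(1-3)] assms(4) partner_less [OF assms(1-3)]
      partner_lattice [OF assms(1-3)] by blast
qed

text \<open>Substituting \<open>M\<^sup>*\<xi>\<close> maps a frequency \<open>k\<close> to \<open>M k\<close>, so all frequencies stay integral.\<close>

lemma trig_poly_polyphase_sum: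
  fixes m :: nat
  assumes "\<And>k. k < m \<Longrightarrow> trig_poly (\<mu> k)"
  shows "trig_poly (\<lambda>\<xi>. u * (\<Sum>k<m. char_exp (of_int_vec (s k)) \<xi> * \<mu> k (mstar M *v \<xi>)))"
proof -
  have "(\<lambda>\<xi>. \<mu> k (mstar M *v \<xi>) * char_exp (of_int_vec (s k)) \<xi>) \<in> exp_sums int_lattice"
    if "k < m" for k
  proof -
    have "\<mu> k \<in> exp_sums int_lattice"
      using assms [OF that] by (simp add: trig_poly_iff_exp_sums)
    then have "(\<lambda>\<xi>. \<mu> k (mstar M *v \<xi>)) \<in> exp_sums ((*v) (real_mat M) ` int_lattice)"
      unfolding mstar_def by (rule exp_sums_comp_transpose)
    then have "(\<lambda>\<xi>. \<mu> k (mstar M *v \<xi>) * char_exp (of_int_vec (s k)) \<xi>) \<in>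
        exp_sums ((\<lambda>a. a + of_int_vec (s k)) ` (*v) (real_mat M) ` int_lattice)"
      by (rule exp_sums_mult_char_exp)
    moreover have "(\<lambda>a. a + of_int_vec (s k)) ` (*v) (real_mat M) ` int_lattice \<subseteq> int_lattice"
      by (auto simp: int_lattice_def real_mat_of_int_vec of_int_vec_simps(2) [symmetric])
    ultimately show ?thesis
      by (metis exp_sums_mono)
  qed
  then have "(\<lambda>\<xi>. \<Sum>k<m. u * (\<mu> k (mstar M *v \<xi>) * char_exp (of_int_vec (s k)) \<xi>)) \<in> exp_sums int_lattice"
    by (intro exp_sums_lincomb) auto
  then show ?thesis
    by (simp add: trig_poly_iff_exp_sums sum_distrib_left mult_ac)
qed

section \<open>Symmetric masks with prescribed Taylor data\<close>

text \<open>A vector with \<open>2x\<close> integral has fractional parts 0 and 1/2 only.\<close>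

lemma semi_degree_fractional_part:
  fixes x :: "real^'d"
  assumes "2 *\<^sub>R x \<in> int_lattice"
  shows "x - vec_floor x \<in> semi_degrees" "2 *\<^sub>R (x - vec_floor x) \<in> int_lattice"
proof -
  obtain z where z: "2 *\<^sub>R x = of_int_vec z"
    using assms by (auto simp: int_lattice_def)
  have "2 *\<^sub>R (x - vec_floor x) = of_int_vec (z - 2 *s (\<chi> j. \<lfloor>x $ j\<rfloor>))"
    unfolding scaleR_diff_right z by (simp add: of_int_vec_def vec_floor_def vec_eq_iff)
  then show lat: "2 *\<^sub>R (x - vec_floor x) \<in> int_lattice"
    by simp
  have "0 \<le> (x - vec_floor x) $ j \<and> (x - vec_floor x) $ j \<le> 1 / 2" for j
  proof -
    have *: "2 * x $ j = of_int (z $ j)"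
      using z by (simp add: of_int_vec_def vec_eq_iff)
    have floor: "of_int \<lfloor>x $ j\<rfloor> \<le> x $ j" "x $ j < of_int \<lfloor>x $ j\<rfloor> + 1"
      by linarith+
    have "real_of_int (z $ j - 2 * \<lfloor>x $ j\<rfloor>) < real_of_int 2"
      using floor * unfolding of_int_diff of_int_mult of_int_numeral by linarith
    then have "z $ j - 2 * \<lfloor>x $ j\<rfloor> \<le> 1"
      unfolding of_int_less_iff by simp
    then have "real_of_int (z $ j - 2 * \<lfloor>x $ j\<rfloor>) \<le> 1"
      by linarith
    then show ?thesis
      using floor * unfolding of_int_diff of_int_mult of_int_numeral vec_floor_def
      by (simp only: vector_minus_component vec_lambda_beta) linarith
  qed
  with lat show "x - vec_floor x \<in> semi_degrees"
    by (simp add: semi_degrees_def half_int_lattice_def)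
qed

lemma vec_floor_in_lattice [simp]: "vec_floor x \<in> int_lattice"
proof -
  have "vec_floor x = of_int_vec (\<chi> j. \<lfloor>x $ j\<rfloor>)"
    by (simp add: vec_floor_def of_int_vec_def)
  then show ?thesis by simp
qed

lemma matrix_vector_mult_minus: "A *v (- x) = - (A *v (x :: real^'d))"
  by (simp add: matrix_vector_mult_def vec_eq_iff sum_negf)

text \<open>Reflection multiplies the term of index \<open>\<gamma>\<close> by \<open>(-1)\<^bsup>[\<beta>-\<gamma>]\<^esup>\<close>; only terms with even \<open>[\<gamma>]\<close>
  survive, and for those this sign is \<open>(-1)\<^bsup>[\<beta>]\<^esup>\<close>.\<close>

lemma reflected_taylor_coefficient:
  fixes u :: "nat^'d \<Rightarrow> complex"
  assumes "\<And>\<gamma>. \<gamma> \<le> \<beta> \<Longrightarrow> odd (mi_size \<gamma>) \<Longrightarrow> u \<gamma> = 0"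
  shows "(\<Sum>\<gamma>\<le>\<beta>. u \<gamma> * of_real (mi_binom \<beta> \<gamma> * mi_power (- b) (\<beta> - \<gamma>))) =
    (- 1) ^ mi_size \<beta> * (\<Sum>\<gamma>\<le>\<beta>. u \<gamma> * of_real (mi_binom \<beta> \<gamma> * mi_power b (\<beta> - \<gamma>)))"
  unfolding sum_distrib_left
proof (rule sum.cong [OF refl])
  fix \<gamma> assume "\<gamma> \<in> {..\<beta>}"
  then have le: "\<gamma> \<le> \<beta>" by simp
  have "mi_size \<beta> = mi_size \<gamma> + mi_size (\<beta> - \<gamma>)"
    using le by (simp add: mi_size_def less_eq_vec_def sum.distrib [symmetric])
  then show "u \<gamma> * of_real (mi_binom \<beta> \<gamma> * mi_power (- b) (\<beta> - \<gamma>)) =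
      (- 1) ^ mi_size \<beta> * (u \<gamma> * of_real (mi_binom \<beta> \<gamma> * mi_power b (\<beta> - \<gamma>)))"
    using assms [OF le] by (cases "even (mi_size \<gamma>)") (simp_all add: mi_power_uminus power_add)
qed

theorem theorem9:
  fixes M :: "int^'d^'d" and s :: "nat \<Rightarrow> int^'d" and c :: "real^'d"
    and m n :: nat and lam lam' :: "nat^'d \<Rightarrow> complex" and I1 I2 :: "nat set"
  assumes dilation: "matrix_dilation M"
    and m: "m = dil_index M"
    and digits: "digit_set M s"
    and c: "c \<in> half_int_lattice"
    and n: "n \<ge> 1"
    and digits_sym: "\<And>i. i \<in> index_I M s c \<Longrightarrow>
          of_int_vec (s i) + of_int_vec (s (partner M s c i)) = 2 *\<^sub>R c"
    and split: "I1 \<union> I2 = index_I M s c" "I1 \<inter> I2 = {}"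
          "\<And>i. i \<in> index_I M s c \<Longrightarrow> i \<in> I1 \<longleftrightarrow> partner M s c i \<in> I2"
    and lam'_0: "lam' 0 = 1"
    and lam'_odd: "\<And>\<alpha>. \<alpha> \<in> Delta n \<Longrightarrow> odd (mi_size \<alpha>) \<Longrightarrow> lam' \<alpha> = 0"
    and lam: "\<And>\<alpha>. \<alpha> \<in> Delta n \<Longrightarrow> lam \<alpha> =
          (\<Sum>\<gamma>\<le>\<alpha>. lam' \<gamma> * of_real (mi_binom \<alpha> \<gamma> * mi_power (minv M *v c) (\<alpha> - \<gamma>)))"
  shows "\<exists>m0 \<mu>. is_mask m0 \<and>
    (\<forall>\<xi>. m0 \<xi> = char_exp (2 *\<^sub>R c) \<xi> * m0 (- \<xi>)) \<and>
    polyphase_components M s m0 \<mu> \<and>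
    (\<forall>\<beta>\<in>Delta n. \<forall>k<m. mixed_deriv \<beta> (\<mu> k) 0 =
       (2 * of_real pi * \<i>) ^ mi_size \<beta> / of_real (sqrt m) *
       (\<Sum>\<alpha>\<le>\<beta>. lam \<alpha> *
          of_real (mi_binom \<beta> \<alpha> * mi_power (- (minv M *v of_int_vec (s k))) (\<beta> - \<alpha>)))) \<and>
    (\<exists>G GA.
       (\<forall>\<beta>\<in>Delta n. \<forall>i\<in>I1. trig_poly (G \<beta> i) \<and> G \<beta> i \<in> Theta \<beta> n) \<and>
       (\<forall>\<beta>\<in>Delta_even n. \<forall>j\<in>index_J M s c.
          semi_trig_poly (minv M *v (c - of_int_vec (s j))
                          - vec_floor (minv M *v (c - of_int_vec (s j)))) (GA \<beta> j) \<and>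
          GA \<beta> j \<in> Theta_sym \<beta> n) \<and>
       (\<forall>\<xi>. m0 \<xi> =
          1 / of_nat m * (\<Sum>j\<in>index_J M s c. \<Sum>\<beta>\<in>Delta n.
             lam' \<beta> * GA \<beta> j (mstar M *v \<xi>) * char_exp c \<xi>) +
          1 / of_nat m * (\<Sum>i\<in>I1. \<Sum>\<beta>\<in>Delta n. \<Sum>\<gamma>\<le>\<beta>.
             lam' \<gamma> * of_real (mi_binom \<beta> \<gamma> *
               mi_power (minv M *v (c - of_int_vec (s i))) (\<beta> - \<gamma>)) *
             (G \<beta> i (mstar M *v \<xi>) * char_exp (of_int_vec (s i)) \<xi> +
              G \<beta> i (- (mstar M *v \<xi>)) * char_exp (2 *\<^sub>R c - of_int_vec (s i)) \<xi>))))"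
proof -
  let ?p = "partner M s c" and ?J = "index_J M s c"
  let ?b = "\<lambda>k. minv M *v (c - of_int_vec (s k))"
  let ?frac = "\<lambda>k. ?b k - vec_floor (?b k)"
  let ?coset = "\<lambda>\<sigma> :: real^'d. range (\<lambda>k. of_int_vec k + \<sigma>)"
  \<comment> \<open>\<open>T k\<close> lists the moments required of the \<open>k\<close>-th polyphase component, up to the factor
    \<open>1/\<surd>m\<close>.\<close>
  define T where "T k \<beta> = (\<Sum>\<gamma>\<le>\<beta>. lam' \<gamma> * of_real (mi_binom \<beta> \<gamma> * mi_power (?b k) (\<beta> - \<gamma>)))" for k \<beta>
  define r :: complex where "r = 1 / of_real (sqrt m)"
  have det: "det M \<noteq> 0"
    using dilation by (rule dilation_det_nonzero)
  have "m > 0"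
    using det by (simp add: m dil_index_def)
  have r2: "r * (r * z) = 1 / of_nat m * z" for z
  proof -
    have "r * r = 1 / of_nat m"
      by (simp add: r_def flip: of_real_mult)
    then show ?thesis
      by (simp only: mult.assoc [symmetric])
  qed
  note partner_m = partner_less [OF det digits c, folded m] partner_partner [OF det digits c, folded m]
  have index: "{..<m} = ?J \<union> (I1 \<union> I2)" "?J \<inter> (I1 \<union> I2) = {}"
    unfolding split(1) by (auto simp: index_J_def index_I_def m)
  then have fin: "finite ?J" "finite I1" "finite I2"
    by (metis finite_Un finite_lessThan)+
  have I1D: "i < m" "?p i \<in> I2" "i \<notin> ?J" if "i \<in> I1" for i
    using that split index by auto
  have I2D: "k < m" "?p k \<in> I1" "k \<notin> ?J" "k \<notin> I1" if "k \<in> I2" for k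
  proof -
    have k: "k \<in> index_I M s c"
      using that split(1) by auto
    with partner_m [of k] have "?p k \<in> index_I M s c" "?p (?p k) = k"
      by (auto simp: index_I_def m)
    with that split show "?p k \<in> I1" by metis
    show "k < m" "k \<notin> ?J" "k \<notin> I1"
      using k that split(2) by (auto simp: index_I_def index_J_def m)
  qed
  have bij: "bij_betw ?p I1 I2"
    by (rule bij_betw_byWitness [where f' = ?p]) (use I1D I2D partner_m in auto)
  have s_partner: "of_int_vec (s (?p i)) = 2 *\<^sub>R c - of_int_vec (s i)" if "i \<in> I1 \<union> I2" for i
    using digits_sym [of i] that split(1) by (auto simp: algebra_simps)
  \<comment> \<open>By the choice of the digits, \<open>s\<^sub>i + s\<^sub>l = 2c\<close> for the partner \<open>l\<close> of \<open>i\<close>.\<close>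
  have b_partner: "?b (?p i) = - ?b i" if "i \<in> I1 \<union> I2" for i
  proof -
    have "c - of_int_vec (s (?p i)) = - (c - of_int_vec (s i))"
      unfolding s_partner [OF that] by (simp add: scaleR_2)
    then show ?thesis
      by (simp only: matrix_vector_mult_minus)
  qed
  have T_partner: "T (?p i) \<beta> = (- 1) ^ mi_size \<beta> * T i \<beta>" if "\<beta> \<in> Delta n" "i \<in> I1 \<union> I2" for i \<beta>
    unfolding T_def b_partner [OF that(2)]
    by (rule reflected_taylor_coefficient) (use lam'_odd Delta_down that(1) in blast)

  have coset_0: "?coset 0 = int_lattice"
    by (simp add: int_lattice_def)
  obtain g where g: "\<And>\<beta>. \<beta> \<in> Delta n \<Longrightarrow> g \<beta> \<in> exp_sums (int_lattice :: (real^'d) set)"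
      "\<And>\<beta>. \<beta> \<in> Delta n \<Longrightarrow> \<forall>\<alpha>\<in>Delta n. moment (g \<beta>) \<alpha> = (if \<alpha> = \<beta> then 1 else 0)"
    by (rule exists_dual_family [of n "0 :: real^'d", unfolded coset_0]) (rule that)
  have frac: "?frac j \<in> semi_degrees" "2 *\<^sub>R ?frac j \<in> int_lattice" if "j \<in> ?J" for j
  proof -
    have "2 *\<^sub>R ?b j = minv M *v (2 *\<^sub>R c - of_int_vec (s j) - of_int_vec (s j))"
      unfolding matrix_vector_mult_scaleR [symmetric] by (simp only: scaleR_2 algebra_simps)
    also have "\<dots> \<in> int_lattice"
      using that partner_lattice [OF det digits c, of j] by (simp add: index_J_def)
    finally show "?frac j \<in> semi_degrees" "2 *\<^sub>R ?frac j \<in> int_lattice"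
      by (rule semi_degree_fractional_part)+
  qed
  define even_dual where "even_dual \<beta> j t \<longleftrightarrow> t \<in> exp_sums (?coset (?frac j)) \<and>
      (\<forall>\<xi>. t (- \<xi>) = t \<xi>) \<and> (\<forall>\<alpha>\<in>Delta n. moment t \<alpha> = (if \<alpha> = \<beta> then 1 else 0))" for \<beta> j t
  \<comment> \<open>For odd \<open>[\<beta>]\<close> the coefficient \<open>lam' \<beta>\<close> vanishes, and the zero function is an
    admissible filler: as the empty sum it has all its frequencies in the coset.\<close>
  define GA where "GA \<beta> j = (if \<beta> \<in> Delta_even n then SOME t. even_dual \<beta> j t else (\<lambda>_. 0))" for \<beta> j
  have GA: "GA \<beta> j \<in> exp_sums (?coset (?frac j)) \<and> (\<forall>\<xi>. GA \<beta> j (- \<xi>) = GA \<beta> j \<xi>) \<and>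
      (\<forall>\<alpha>\<in>Delta n. moment (GA \<beta> j) \<alpha> = (if \<alpha> = \<beta> then 1 else 0))"
    if "\<beta> \<in> Delta_even n" "j \<in> ?J" for \<beta> j
  proof -
    have "\<exists>t. even_dual \<beta> j t"
      using exists_even_dual_exp_sum [OF that(1) frac(2) [OF that(2)]]
      unfolding even_dual_def by blast
    then have "even_dual \<beta> j (GA \<beta> j)"
      unfolding GA_def if_P [OF that(1)] by (rule someI_ex)
    then show ?thesis
      unfolding even_dual_def .
  qed
  have GA_zero: "GA \<beta> j = (\<lambda>_. 0)" if "\<beta> \<notin> Delta_even n" for \<beta> j
    using that by (simp add: GA_def)
  have GA_mem: "GA \<beta> j \<in> exp_sums (?coset (?frac j))" if "j \<in> ?J" for \<beta> j
  proof (cases "\<beta> \<in> Delta_even n")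
    case False
    then show ?thesis
      using exp_sum_in_exp_sums [of "{} :: nat set"] by (simp add: GA_zero)
  qed (use GA that in blast)
  have GA_even: "GA \<beta> j (- \<xi>) = GA \<beta> j \<xi>" if "j \<in> ?J" for \<beta> j \<xi>
    using GA [OF _ that] by (cases "\<beta> \<in> Delta_even n") (auto simp: GA_zero)

  define F where "F j = (\<lambda>\<eta>. \<Sum>\<beta>\<in>Delta n. lam' \<beta> * GA \<beta> j \<eta>)" for j
  define H where "H i = (\<lambda>\<eta>. \<Sum>\<beta>\<in>Delta n. T i \<beta> * g \<beta> \<eta>)" for i
  have F: "F j \<in> exp_sums (?coset (?frac j))" if "j \<in> ?J" for j
    unfolding F_def by (rule exp_sums_lincomb [OF finite_Delta GA_mem [OF that]])
  have moment_F: "moment (F j) \<alpha> = lam' \<alpha>" if "j \<in> ?J" "\<alpha> \<in> Delta n" for j \<alpha>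
    unfolding F_def
  proof (rule moment_dual_lincomb [OF GA_mem [OF that(1)] _ that(2)])
    fix \<beta> assume "\<beta> \<in> Delta n" "lam' \<beta> \<noteq> 0"
    then have "\<beta> \<in> Delta_even n"
      using lam'_odd by (auto simp: Delta_even_def)
    then show "\<forall>\<alpha>\<in>Delta n. moment (GA \<beta> j) \<alpha> = (if \<alpha> = \<beta> then 1 else 0)"
      using GA that(1) by blast
  qed
  have H: "H i \<in> exp_sums int_lattice" for i
    unfolding H_def by (rule exp_sums_lincomb [OF finite_Delta g(1)])
  have moment_H: "moment (H i) \<alpha> = T i \<alpha>" if "\<alpha> \<in> Delta n" for i \<alpha>
    unfolding H_def by (rule moment_dual_lincomb [OF g that])

  \<comment> \<open>Over \<open>J\<close> the character moves the half-integral frequencies back to integers and shifts the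
    moments from \<open>lam'\<close> to \<open>T k\<close>; over \<open>I2\<close> the component is the reflection of the partner's.\<close>
  define \<mu> where "\<mu> k = (if k \<in> ?J then (\<lambda>\<eta>. r * (F k \<eta> * char_exp (?b k) \<eta>))
      else if k \<in> I1 then (\<lambda>\<eta>. r * H k \<eta>) else (\<lambda>\<eta>. r * H (?p k) (- \<eta>)))" for k
  have \<mu>: "\<mu> k \<in> exp_sums int_lattice \<and> (\<forall>\<beta>\<in>Delta n. moment (\<mu> k) \<beta> = r * T k \<beta>)" if "k < m" for k
  proof -
    have "k \<in> ?J \<union> (I1 \<union> I2)"
      using that unfolding index(1) [symmetric] by simp
    then consider (J) "k \<in> ?J" | (I1) "k \<in> I1" | (I2) "k \<in> I2"
      by blast
    then show ?thesis
    proof cases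
      case J
      let ?f = "\<lambda>\<eta>. F k \<eta> * char_exp (?b k) \<eta>"
      have shift: "x + ?b k \<in> int_lattice" if x: "x \<in> ?coset (?frac k)" for x
      proof -
        \<comment> \<open>The frequencies lie in the coset of \<open>M\<^sup>-\<^sup>1(c - s\<^sub>k)\<close>, and the character adds this vector once
          more; twice the vector is integral on \<open>J\<close>.\<close>
        have "x + ?b k = (x - ?frac k) + 2 *\<^sub>R ?frac k + vec_floor (?b k)"
          by (simp add: scaleR_2)
        also have "\<dots> \<in> int_lattice"
          using x [unfolded mem_lattice_coset] frac(2) [OF J]
          by (intro int_lattice_add vec_floor_in_lattice)
        finally show ?thesis .
      qed
      have f: "?f \<in> exp_sums int_lattice"
        by (rule exp_sums_mono [OF image_subsetI [OF shift] exp_sums_mult_char_exp [OF F [OF J]]])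
      have moment_f: "moment ?f \<beta> = T k \<beta>" if "\<beta> \<in> Delta n" for \<beta>
        unfolding moment_mult_char_exp [OF F [OF J]] T_def
        by (intro sum.cong refl) (simp add: moment_F [OF J] Delta_down [OF _ that])
      have eq: "\<mu> k = (\<lambda>\<eta>. r * ?f \<eta>)"
        unfolding \<mu>_def if_P [OF J] ..
      show ?thesis
        unfolding eq moment_scale [OF f] using exp_sums_scale [OF f] moment_f by simp
    next
      case I1
      then have eq: "\<mu> k = (\<lambda>\<eta>. r * H k \<eta>)"
        using I1D by (simp add: \<mu>_def)
      show ?thesis
        unfolding eq moment_scale [OF H] using exp_sums_scale [OF H] moment_H by simp
    next
      case I2
      then have eq: "\<mu> k = (\<lambda>\<eta>. r * H (?p k) (- \<eta>))"
        using I2D by (simp add: \<mu>_def)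
      have f: "(\<lambda>\<eta>. H (?p k) (- \<eta>)) \<in> exp_sums int_lattice"
        by (rule exp_sums_mono [OF image_subsetI [OF int_lattice_uminus] exp_sums_comp_uminus [OF H]])
      have moment_f: "moment (\<lambda>\<eta>. H (?p k) (- \<eta>)) \<beta> = T k \<beta>" if "\<beta> \<in> Delta n" for \<beta>
        using I2 that
        by (simp add: moment_comp_uminus [OF H] moment_H T_partner flip: mult.assoc power_mult_distrib)
      show ?thesis
        unfolding eq moment_scale [OF f] using exp_sums_scale [OF f] moment_f by simp
    qed
  qed

  define m0 where "m0 = (\<lambda>\<xi>. r * (\<Sum>k<m. char_exp (of_int_vec (s k)) \<xi> * \<mu> k (mstar M *v \<xi>)))"
  let ?A = "\<lambda>j \<xi>. \<Sum>\<beta>\<in>Delta n. lam' \<beta> * GA \<beta> j (mstar M *v \<xi>) * char_exp c \<xi>"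
  let ?G = "\<lambda>i \<beta> \<xi>. g \<beta> (mstar M *v \<xi>) * char_exp (of_int_vec (s i)) \<xi> +
      g \<beta> (- (mstar M *v \<xi>)) * char_exp (2 *\<^sub>R c - of_int_vec (s i)) \<xi>"
  let ?B = "\<lambda>i \<xi>. \<Sum>\<beta>\<in>Delta n. \<Sum>\<gamma>\<le>\<beta>.
      lam' \<gamma> * of_real (mi_binom \<beta> \<gamma> * mi_power (?b i) (\<beta> - \<gamma>)) * ?G i \<beta> \<xi>"
  \<comment> \<open>The characters of the digits combine with the shifts: \<open>s\<^sub>j + (c - s\<^sub>j) = c\<close> over \<open>J\<close>, and the
    components of \<open>I2\<close> are summed together with their partners in \<open>I1\<close>.\<close>
  have rep: "m0 \<xi> = 1 / of_nat m * (\<Sum>j\<in>?J. ?A j \<xi>) + 1 / of_nat m * (\<Sum>i\<in>I1. ?B i \<xi>)" for \<xi>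
  proof -
    let ?E = "\<lambda>k. char_exp (of_int_vec (s k)) \<xi> * \<mu> k (mstar M *v \<xi>)"
    have "(\<Sum>k<m. ?E k) = (\<Sum>k\<in>?J. ?E k) + ((\<Sum>k\<in>I1. ?E k) + (\<Sum>k\<in>I2. ?E k))"
      unfolding index(1) using fin index(2) split(2) by (simp add: sum.union_disjoint)
    also have "(\<Sum>k\<in>I2. ?E k) = (\<Sum>i\<in>I1. ?E (?p i))"
      by (rule sum.reindex_bij_betw [OF bij, symmetric])
    also have "(\<Sum>k\<in>?J. ?E k) = (\<Sum>j\<in>?J. r * ?A j \<xi>)"
    proof (rule sum.cong [OF refl])
      fix j assume j: "j \<in> ?J"
      have "char_exp (of_int_vec (s j)) \<xi> * char_exp (?b j) (mstar M *v \<xi>) = char_exp c \<xi>"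
        unfolding char_exp_minv_mstar [OF det] char_exp_add [symmetric] by simp
      moreover have "?E j = r * (F j (mstar M *v \<xi>) *
          (char_exp (of_int_vec (s j)) \<xi> * char_exp (?b j) (mstar M *v \<xi>)))"
        using j by (simp add: \<mu>_def)
      ultimately show "?E j = r * ?A j \<xi>"
        by (simp only: F_def sum_distrib_right)
    qed
    also have "(\<Sum>k\<in>I1. ?E k) + (\<Sum>i\<in>I1. ?E (?p i)) = (\<Sum>i\<in>I1. r * ?B i \<xi>)"
      unfolding sum.distrib [symmetric]
    proof (rule sum.cong [OF refl])
      fix i assume i: "i \<in> I1"
      have \<mu>_i: "\<mu> i = (\<lambda>\<eta>. r * H i \<eta>)"
        using i I1D by (simp add: \<mu>_def)
      have \<mu>_p: "\<mu> (?p i) = (\<lambda>\<eta>. r * H i (- \<eta>))"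
        using I1D [OF i] I2D [of "?p i"] partner_m by (simp add: \<mu>_def)
      have s_p: "of_int_vec (s (?p i)) = 2 *\<^sub>R c - of_int_vec (s i)"
        using i s_partner by blast
      have "?E i + ?E (?p i) = r * (\<Sum>\<beta>\<in>Delta n. T i \<beta> * ?G i \<beta> \<xi>)"
        unfolding \<mu>_i \<mu>_p s_p H_def sum_distrib_left sum.distrib [symmetric]
        by (intro sum.cong refl) (simp only: distrib_left mult_ac)
      then show "?E i + ?E (?p i) = r * ?B i \<xi>"
        by (simp only: T_def sum_distrib_right)
    qed
    finally show ?thesis
      by (simp only: m0_def sum_distrib_left [symmetric] distrib_left r2)
  qed

  \<comment> \<open>Visible from the representation: the terms over \<open>J\<close> are even functions times the character
    of \<open>c\<close>, and in each term over \<open>I1\<close> the two summands are exchanged.\<close>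
  have sym: "m0 \<xi> = char_exp (2 *\<^sub>R c) \<xi> * m0 (- \<xi>)" for \<xi>
  proof -
    have A: "char_exp (2 *\<^sub>R c) \<xi> * ?A j (- \<xi>) = ?A j \<xi>" if "j \<in> ?J" for j
    proof -
      have "char_exp (2 *\<^sub>R c) \<xi> * (u * char_exp c (- \<xi>)) = u * char_exp c \<xi>" for u
        by (simp add: char_exp_uminus scaleR_2 flip: mult.assoc char_exp_add)
      then show ?thesis
        unfolding sum_distrib_left
        by (intro sum.cong refl) (simp add: matrix_vector_mult_minus GA_even [OF that])
    qed
    have G: "char_exp (2 *\<^sub>R c) \<xi> * ?G i \<beta> (- \<xi>) = ?G i \<beta> \<xi>" for i \<beta>
    proof -
      have shift: "char_exp (2 *\<^sub>R c) \<xi> * (u * char_exp a (- \<xi>)) = u * char_exp (2 *\<^sub>R c - a) \<xi>" for u a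
        using char_exp_add [of "2 *\<^sub>R c" "- a" \<xi>] by (simp add: char_exp_uminus)
      show ?thesis
        unfolding matrix_vector_mult_minus minus_minus distrib_left shift
        by (simp add: add.commute)
    qed
    have B: "char_exp (2 *\<^sub>R c) \<xi> * ?B i (- \<xi>) = ?B i \<xi>" for i
      unfolding sum_distrib_left mult.left_commute [of "char_exp (2 *\<^sub>R c) \<xi>"] G ..
    have "char_exp (2 *\<^sub>R c) \<xi> * m0 (- \<xi>) =
        1 / of_nat m * (\<Sum>j\<in>?J. char_exp (2 *\<^sub>R c) \<xi> * ?A j (- \<xi>)) +
        1 / of_nat m * (\<Sum>i\<in>I1. char_exp (2 *\<^sub>R c) \<xi> * ?B i (- \<xi>))"
      unfolding rep by (simp only: sum_distrib_left [symmetric] distrib_left mult.left_commute)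
    also have "\<dots> = m0 \<xi>"
      unfolding rep B by (simp only: A cong: sum.cong)
    finally show ?thesis ..
  qed

  have zero: "(0 :: nat^'d) \<in> Delta n"
    using n by (simp add: Delta_def mi_size_def)
  have "T k 0 = 1" for k
  proof -
    have "{..0 :: nat^'d} = {0}"
      by (auto simp: less_eq_vec_def vec_eq_iff)
    then show ?thesis
      by (simp add: T_def lam'_0 mi_binom_def mi_fact_def mi_power_def)
  qed
  then have "\<mu> k 0 = r" if "k < m" for k
    using \<mu> [OF that] zero by (simp add: moment_0 [symmetric])
  then have "m0 0 = r * (r * of_nat m)"
    by (simp add: m0_def)
  with \<open>m > 0\<close> have m0_0: "m0 0 = 1"
    by (simp add: r2)
  have trig: "trig_poly m0"
    unfolding m0_def by (rule trig_poly_polyphase_sum) (simp add: trig_poly_iff_exp_sums \<mu>)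

  have witness: "\<exists>G GA. P G GA" if "P (\<lambda>\<beta> i. g \<beta>) GA"
    for P :: "(nat^'d \<Rightarrow> nat \<Rightarrow> real^'d \<Rightarrow> complex) \<Rightarrow> _ \<Rightarrow> bool"
    using that by (intro exI)
  show ?thesis
  proof (rule exI [of _ m0], rule exI [of _ \<mu>], intro conjI ballI allI impI witness)
    show "is_mask m0"
      using trig m0_0 by (simp add: is_mask_def)
    show "m0 \<xi> = char_exp (2 *\<^sub>R c) \<xi> * m0 (- \<xi>)" for \<xi>
      by (rule sym)
    show "polyphase_components M s m0 \<mu>"
      using \<mu> by (simp add: polyphase_components_def trig_poly_iff_exp_sums m0_def r_def m)
    show "trig_poly (g \<beta>)" "g \<beta> \<in> Theta \<beta> n" if "\<beta> \<in> Delta n" for \<beta>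
    proof -
      show "trig_poly (g \<beta>)"
        using g(1) [OF that] by (simp add: trig_poly_iff_exp_sums)
      then show "g \<beta> \<in> Theta \<beta> n"
        using g(2) [OF that] unfolding mem_Theta_iff by blast
    qed
    show "semi_trig_poly (?frac j) (GA \<beta> j)" "GA \<beta> j \<in> Theta_sym \<beta> n"
      if "\<beta> \<in> Delta_even n" "j \<in> ?J" for \<beta> j
    proof -
      show "semi_trig_poly (?frac j) (GA \<beta> j)"
        using GA [OF that] frac(1) [OF that(2)] by (simp add: semi_trig_poly_iff_exp_sums)
      then show "GA \<beta> j \<in> Theta_sym \<beta> n"
        using GA [OF that] unfolding Theta_sym_def mem_Theta_iff mem_Collect_eq by metis
    qed
    show "m0 \<xi> = 1 / of_nat m * (\<Sum>j\<in>?J. ?A j \<xi>) + 1 / of_nat m * (\<Sum>i\<in>I1. ?B i \<xi>)" for \<xi>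
      by (rule rep)
    fix \<beta> :: "nat^'d" and k assume \<beta>: "\<beta> \<in> Delta n" and "k < m"
    have "minv M *v c + - (minv M *v of_int_vec (s k)) = ?b k"
      by (simp add: matrix_vector_mult_diff_distrib)
    with umbral_composition [of n lam lam' "minv M *v c", OF lam \<beta>, of "- (minv M *v of_int_vec (s k))"]
    have "(\<Sum>\<alpha>\<le>\<beta>. lam \<alpha> *
        of_real (mi_binom \<beta> \<alpha> * mi_power (- (minv M *v of_int_vec (s k))) (\<beta> - \<alpha>))) = T k \<beta>"
      by (simp only: T_def)
    with \<mu> [OF \<open>k < m\<close>] \<beta>
    show "mixed_deriv \<beta> (\<mu> k) 0 = (2 * of_real pi * \<i>) ^ mi_size \<beta> / of_real (sqrt m) *
       (\<Sum>\<alpha>\<le>\<beta>. lam \<alpha> *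
          of_real (mi_binom \<beta> \<alpha> * mi_power (- (minv M *v of_int_vec (s k))) (\<beta> - \<alpha>)))"
      by (simp add: mixed_deriv_eq_moment r_def)
  qed
qed

end
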